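(* Let $\mu,\nu\in P_1(\mathbb{R}^d)$. Assume that $h:\mathbb{R}^d\to[0,\infty)$ is convex and $L$-Lipschitz with constant $L>0$, and let the cost be $c(x,y)=h(x-y)$. Then $D_c(\mu,P_{\leqslant\nu})$ and $D_c(P_{\mu\leqslant},\nu)$ are attained in the class $\mathcal{A}\cap\mathrm{Lip}$. Moreover, both of these optimal potentials (the backward one and the forward one) are $L$-Lipschitz; that is, each of the two dual problems has an optimizer which is convex and $L$-Lipschitz.
   Context: $P_1(\mathbb{R}^d)$ is the set of Borel probability measures on $\mathbb{R}^d$ with finite first moment. $\mathcal{A}$ is the set of real-valued convex functions on $\mathbb{R}^d$; $\mathrm{Lip}$ is the set of Lipschitz functions on $\mathbb{R}^d$. $C_{b,1}$ is the set of continuous $f:\mathbb{R}^d\to\mathbb{R}$ such that $f(x)/(1+|x|)$ is bounded. Transforms: $Q_c(\varphi)(x)=\inf_{y}\{\varphi(y)+c(x,y)\}$, $Q_{\bar c}(\psi)(y)=\sup_{x}\{\psi(x)-c(x,y)\}$. Dual problems (of the Wasserstein projections in convex order, with $p=1$): $D_c(\mu,P_{\leqslant\nu})=\sup_{\varphi\in\mathcal{A}\cap C_{b,1}}\{\int Q_c(\varphi)d\mu-\int\varphi\,d\nu\}$ and $D_c(P_{\mu\leqslant},\nu)=\sup_{\psi\in\mathcal{A}\cap C_{b,1}}\{\int\psi\,d\mu-\int Q_{\bar c}(\psi)d\nu\}$. Here $P_{\leqslant\nu}$, $P_{\mu\leqslant}$ denote the sets of measures in $P_1(\mathbb{R}^d)$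 that are respectively dominated by $\nu$ and dominating $\mu$ in the convex order. A dual is attained by a function if the corresponding functional evaluated at it equals the supremum. *)

theory Defs
  imports "HOL-Probability.Probability"
begin

definition P1 :: "'a::euclidean_space measure set" where
  "P1 = {\<mu>. prob_space \<mu> \<and> sets \<mu> = sets borel \<and> integrable \<mu> norm}"

definition Cvx :: "('a::euclidean_space \<Rightarrow> real) set" where
  "Cvx = {f. convex_on UNIV f}"

definition Lip :: "('a::euclidean_space \<Rightarrow> real) set" where
  "Lip = {f. \<exists>K. K-lipschitz_on UNIV f}"

definition Cb1 :: "('a::euclidean_space \<Rightarrow> real) set" where
  "Cb1 = {f. continuous_on UNIV f \<and> bounded (range (\<lambda>x. f x / (1 + norm x)))}"

text \<open>For \<open>\<phi>\<close> in \<open>Cvx \<inter> Cb1\<close> the infimum below can be minus infinity (for instance if \<open>\<phi>\<close> is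
  linear and steeper than the cost), and dually the supremum can be plus infinity, so both
  transforms take extended real values.\<close>

definition Qc :: "('a::euclidean_space \<Rightarrow> 'a \<Rightarrow> real) \<Rightarrow> ('a \<Rightarrow> real) \<Rightarrow> 'a \<Rightarrow> ereal" where
  "Qc c \<phi> x = (INF y. ereal (\<phi> y + c x y))"

definition Qcbar :: "('a::euclidean_space \<Rightarrow> 'a \<Rightarrow> real) \<Rightarrow> ('a \<Rightarrow> real) \<Rightarrow> 'a \<Rightarrow> ereal" where
  "Qcbar c \<psi> y = (SUP x. ereal (\<psi> x - c x y))"

text \<open>Integral of an extended real valued function, as the integral of the positive part minus that
  of the negative part (\<open>e2ennreal\<close> truncates negative values to 0). It is only used where at most
  one of the two parts is infinite: if \<open>\<phi>\<close>, \<open>\<psi>\<close> and the diagonal cost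
  \<open>c x x\<close> are integrable, then \<open>Qc c \<phi> x \<le> \<phi> x + c x x\<close> and \<open>Qcbar c \<psi> y \<ge> \<psi> y - c y y\<close> bound one part.\<close>

definition ext_integral :: "'a measure \<Rightarrow> ('a \<Rightarrow> ereal) \<Rightarrow> ereal" where
  "ext_integral M f =
     enn2ereal (\<integral>\<^sup>+ x. e2ennreal (f x) \<partial>M) - enn2ereal (\<integral>\<^sup>+ x. e2ennreal (- f x) \<partial>M)"

lemma ext_integral_ereal:
  fixes f :: "'a \<Rightarrow> real"
  assumes "integrable M f"
  shows "ext_integral M (\<lambda>x. ereal (f x)) = ereal (\<integral>x. f x \<partial>M)"
proof -
  have fin: "(\<integral>\<^sup>+ x. ennreal (f x) \<partial>M) \<noteq> \<infinity>" "(\<integral>\<^sup>+ x. ennreal (- f x) \<partial>M) \<noteq> \<infinity>"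
    using assms by (auto simp: real_integrable_def)
  have "enn2ereal a - enn2ereal b = ereal (enn2real a - enn2real b)"
    if "a \<noteq> \<infinity>" "b \<noteq> \<infinity>" for a b :: ennreal
    using that by (cases a; cases b) (auto simp: enn2ereal_ennreal)
  with fin show ?thesis
    by (simp add: ext_integral_def real_lebesgue_integral_def[OF assms] flip: ennreal.abs_eq)
qed

definition backward_functional ::
  "('a::euclidean_space \<Rightarrow> 'a \<Rightarrow> real) \<Rightarrow> 'a measure \<Rightarrow> 'a measure \<Rightarrow> ('a \<Rightarrow> real) \<Rightarrow> ereal" where
  "backward_functional c \<mu> \<nu> \<phi> = ext_integral \<mu> (Qc c \<phi>) - ereal (\<integral>y. \<phi> y \<partial>\<nu>)"

definition forward_functional ::
  "('a::euclidean_space \<Rightarrow> 'a \<Rightarrow> real) \<Rightarrow> 'a measure \<Rightarrow> 'a measure \<Rightarrow> ('a \<Rightarrow> real) \<Rightarrow> ereal" where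
  "forward_functional c \<mu> \<nu> \<psi> = ereal (\<integral>x. \<psi> x \<partial>\<mu>) - ext_integral \<nu> (Qcbar c \<psi>)"

text \<open>The dual of projecting \<open>\<mu>\<close> onto the measures dominated by \<open>\<nu>\<close> in convex order (backward), and
  of projecting \<open>\<nu>\<close> onto the measures dominating \<open>\<mu>\<close> in convex order (forward).\<close>

definition backward_dual ::
  "('a::euclidean_space \<Rightarrow> 'a \<Rightarrow> real) \<Rightarrow> 'a measure \<Rightarrow> 'a measure \<Rightarrow> ereal" where
  "backward_dual c \<mu> \<nu> = (SUP \<phi> \<in> Cvx \<inter> Cb1. backward_functional c \<mu> \<nu> \<phi>)"

definition forward_dual ::
  "('a::euclidean_space \<Rightarrow> 'a \<Rightarrow> real) \<Rightarrow> 'a measure \<Rightarrow> 'a measure \<Rightarrow> ereal" where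
  "forward_dual c \<mu> \<nu> = (SUP \<psi> \<in> Cvx \<inter> Cb1. forward_functional c \<mu> \<nu> \<psi>)"

end

theory Submission imports Defs "HOL-Complex_Analysis.Great_Picard" begin

text \<open>Both dual problems reduce to one symmetric problem: maximize
  \<open>\<integral>a d\<mu> - \<integral>b d\<nu>\<close> over pairs of convex \<open>L\<close>-Lipschitz functions with
  \<open>a x \<le> b y + h (x - y)\<close>. Indeed, if \<open>Qc c \<phi>\<close> is finite then it is convex and
  \<open>L\<close>-Lipschitz, and so is \<open>Qcbar c (Qc c \<phi>) \<le> \<phi>\<close>, the convexity because
  \<open>Qcbar c a y = (SUP z. a (y + z) - h z)\<close>; passing to this pair does not decrease the backward
  functional. The forward case is the same with the pair \<open>(Qc c (Qcbar c \<psi>), Qcbar c \<psi>)\<close>.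
  After the normalization \<open>b 0 = 0\<close> the pairs of a maximizing sequence are equi-Lipschitz and bounded
  at \<open>0\<close>, so a subsequence converges pointwise, and dominated convergence shows that the limit
  \<open>(a, b)\<close> is optimal. Then \<open>b\<close> is a backward and \<open>a\<close> a forward optimizer.\<close>

section \<open>Infima and suprema of families of Lipschitz or convex functions\<close>

lemma lipschitz_on_real_le:
  fixes f :: "'a::metric_space \<Rightarrow> real"
  assumes "L-lipschitz_on UNIV f"
  shows "f x \<le> f y + L * dist x y"
  using lipschitz_onD[OF assms, of x y] by (auto simp: dist_real_def)

lemma lipschitz_on_realI:
  fixes f :: "'a::metric_space \<Rightarrow> real"
  assumes "0 \<le> L" and le: "\<And>x y. f x \<le> f y + L * dist x y"
  shows "L-lipschitz_on UNIV f"
proof (rule lipschitz_onI)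
  fix x y
  show "dist (f x) (f y) \<le> L * dist x y"
    using le[of x y] le[of y x] by (simp add: dist_real_def dist_commute abs_le_iff)
qed fact

text \<open>All members share the constant \<open>L\<close>, so moving from \<open>p\<close> to
  \<open>x\<close> costs at most \<open>L * dist p x\<close>, uniformly in \<open>i\<close>. This is
  why a transform that is finite at one point is finite everywhere.\<close>

lemma bdd_below_lipschitz_family:
  fixes f :: "'i \<Rightarrow> 'a::metric_space \<Rightarrow> real"
  assumes lip: "\<And>i. L-lipschitz_on UNIV (f i)" and bdd: "bdd_below (range (\<lambda>i. f i p))"
  shows "bdd_below (range (\<lambda>i. f i x))"
proof -
  obtain m where "m \<le> f i p" for i
    using bdd by (auto simp: bdd_below_def)
  then have "m - L * dist p x \<le> f i x" for i
    using lipschitz_on_real_le[OF lip, of i p x] by (smt (verit))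
  then show ?thesis
    by (rule bdd_belowI2)
qed

lemma lipschitz_on_INF:
  fixes f :: "'i \<Rightarrow> 'a::metric_space \<Rightarrow> real"
  assumes "0 \<le> L" and lip: "\<And>i. L-lipschitz_on UNIV (f i)"
    and bdd: "\<And>x. bdd_below (range (\<lambda>i. f i x))"
  shows "L-lipschitz_on UNIV (\<lambda>x. INF i. f i x)"
proof (rule lipschitz_on_realI)
  fix x y
  have "(INF i. f i x) - L * dist x y \<le> f i y" for i
    using cINF_lower[OF bdd, of i x] lipschitz_on_real_le[OF lip, of i x y] by simp
  then have "(INF i. f i x) - L * dist x y \<le> (INF i. f i y)"
    by (intro cINF_greatest) auto
  then show "(INF i. f i x) \<le> (INF i. f i y) + L * dist x y"
    by simp
qed fact

lemma convex_on_SUP_of_real: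
  fixes f :: "'i \<Rightarrow> 'a::real_vector \<Rightarrow> real"
  assumes cvx: "\<And>i. convex_on UNIV (f i)" and bdd: "\<And>x. bdd_above (range (\<lambda>i. f i x))"
  shows "convex_on UNIV (\<lambda>x. SUP i. f i x)"
proof (rule convex_onI)
  fix t :: real and x y
  assume t: "0 < t" "t < 1"
  show "(SUP i. f i ((1 - t) *\<^sub>R x + t *\<^sub>R y)) \<le> (1 - t) * (SUP i. f i x) + t * (SUP i. f i y)"
  proof (rule cSUP_least)
    fix i
    have "f i ((1 - t) *\<^sub>R x + t *\<^sub>R y) \<le> (1 - t) * f i x + t * f i y"
      using t by (intro convex_onD[OF cvx]) auto
    also have "\<dots> \<le> (1 - t) * (SUP i. f i x) + t * (SUP i. f i y)"
      using t by (intro add_mono mult_left_mono cSUP_upper bdd) auto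
    finally show "f i ((1 - t) *\<^sub>R x + t *\<^sub>R y) \<le> (1 - t) * (SUP i. f i x) + t * (SUP i. f i y)" .
  qed simp
qed simp

text \<open>The map sending \<open>(x, y)\<close> to \<open>\<phi> y + h (x - y)\<close> is jointly
  convex, and minimizing over one variable preserves convexity: combining competitors for
  \<open>x1\<close> and \<open>x2\<close> with the same weights gives a competitor for the combined
  point.\<close>

lemma convex_on_infimal_convolution:
  fixes \<phi> h :: "'a::real_vector \<Rightarrow> real"
  assumes \<phi>: "convex_on UNIV \<phi>" and h: "convex_on UNIV h"
    and bdd: "\<And>x. bdd_below (range (\<lambda>y. \<phi> y + h (x - y)))"
  shows "convex_on UNIV (\<lambda>x. INF y. \<phi> y + h (x - y))"
proof (rule convex_onI)
  let ?q = "\<lambda>x. INF y. \<phi> y + h (x - y)"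
  fix t :: real and x1 x2
  assume t: "0 < t" "t < 1"
  show "?q ((1 - t) *\<^sub>R x1 + t *\<^sub>R x2) \<le> (1 - t) * ?q x1 + t * ?q x2"
  proof (rule field_le_epsilon)
    fix e :: real
    assume e: "0 < e"
    \<comment> \<open>The infimum need not be attained, so minimizers up to \<open>e\<close> are
      used.\<close>
    obtain y1 where y1: "\<phi> y1 + h (x1 - y1) < ?q x1 + e"
      using cINF_less_iff[OF UNIV_not_empty bdd[of x1], of "?q x1 + e"] e by auto
    obtain y2 where y2: "\<phi> y2 + h (x2 - y2) < ?q x2 + e"
      using cINF_less_iff[OF UNIV_not_empty bdd[of x2], of "?q x2 + e"] e by auto
    let ?x = "(1 - t) *\<^sub>R x1 + t *\<^sub>R x2" and ?y = "(1 - t) *\<^sub>R y1 + t *\<^sub>R y2"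
    have diff: "?x - ?y = (1 - t) *\<^sub>R (x1 - y1) + t *\<^sub>R (x2 - y2)"
      by (simp add: algebra_simps)
    have "?q ?x \<le> \<phi> ?y + h (?x - ?y)"
      by (rule cINF_lower[OF bdd]) simp
    also have "\<dots> \<le> ((1 - t) * \<phi> y1 + t * \<phi> y2) + ((1 - t) * h (x1 - y1) + t * h (x2 - y2))"
      unfolding diff using t by (intro add_mono convex_onD[OF \<phi>] convex_onD[OF h]) auto
    also have "\<dots> = (1 - t) * (\<phi> y1 + h (x1 - y1)) + t * (\<phi> y2 + h (x2 - y2))"
      by (simp add: algebra_simps)
    also have "\<dots> \<le> (1 - t) * (?q x1 + e) + t * (?q x2 + e)"
      using t y1 y2 by (intro add_mono[OF mult_left_mono mult_left_mono]) auto
    also have "\<dots> = (1 - t) * ?q x1 + t * ?q x2 + e"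
      by (simp add: algebra_simps)
    finally show "?q ?x \<le> (1 - t) * ?q x1 + t * ?q x2 + e" .
  qed
qed simp

section \<open>Compactness and pointwise limits\<close>

text \<open>Arzela-Ascoli argument: a diagonal subsequence converges on a countable dense set, and
  the common Lipschitz constant carries the Cauchy property to every other point.\<close>

lemma lipschitz_pointwise_convergent_subsequence:
  fixes f :: "nat \<Rightarrow> 'a::euclidean_space \<Rightarrow> real"
  assumes lip: "\<And>n. L-lipschitz_on UNIV (f n)" and bdd: "\<And>n. \<bar>f n 0\<bar> \<le> B"
  obtains r g where "strict_mono (r :: nat \<Rightarrow> nat)" "\<And>x. (\<lambda>n. f (r n) x) \<longlonglongrightarrow> g x"
proof -
  have L: "0 \<le> L"
    using lip lipschitz_on_nonneg by blast
  have B: "0 \<le> B"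
    using bdd[of 0] abs_ge_zero order_trans by blast
  obtain D :: "'a set" where D: "countable D" "\<And>X. open X \<Longrightarrow> X \<noteq> {} \<Longrightarrow> \<exists>d\<in>D. d \<in> X"
    by (erule countable_dense_setE)
  \<comment> \<open>The diagonal extraction asks for one bound valid for all \<open>n\<close> and
    \<open>x\<close>. The functions grow at most linearly, so dividing by \<open>1 + norm x\<close>
    provides it; the factor is multiplied back pointwise later.\<close>
  have "norm (f n x / (1 + norm x)) \<le> B + L" for n x
  proof -
    have "\<bar>f n x\<bar> \<le> \<bar>f n 0\<bar> + L * norm x"
      using lipschitz_onD[OF lip, of x 0 n] by (simp add: dist_real_def)
    also have "\<dots> \<le> (B + L) * (1 + norm x)"
      unfolding distrib_left distrib_right using bdd[of n] L mult_nonneg_nonneg[OF B norm_ge_zero, of x]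
      by linarith
    finally show ?thesis
      using norm_ge_zero[of x] by (simp add: pos_divide_le_eq add_pos_nonneg)
  qed
  then obtain r where r: "strict_mono (r :: nat \<Rightarrow> nat)"
    and conv: "\<And>x. x \<in> D \<Longrightarrow> \<exists>l. (\<lambda>n. f (r n) x / (1 + norm x)) \<longlonglongrightarrow> l"
    using function_convergent_subsequence[OF D(1), of "\<lambda>n x. f n x / (1 + norm x)" "B + L"] by blast
  have "convergent (\<lambda>n. f (r n) x)" for x
  proof (rule Cauchy_convergent, rule metric_CauchyI)
    fix e :: real
    assume e: "0 < e"
    \<comment> \<open>\<open>L + 1\<close> instead of \<open>L\<close> avoids a division by zero
      when \<open>L = 0\<close>.\<close>
    have "0 < e / (3 * (L + 1))"
      using e L by simp
    then have "x \<in> ball x (e / (3 * (L + 1)))"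
      by simp
    then obtain d where d: "d \<in> D" "dist d x < e / (3 * (L + 1))"
      using D(2)[OF open_ball] unfolding mem_ball by (metis dist_commute empty_iff mem_ball)
    obtain l where "(\<lambda>n. f (r n) d / (1 + norm d)) \<longlonglongrightarrow> l"
      using conv d by blast
    then have "(\<lambda>n. f (r n) d / (1 + norm d) * (1 + norm d)) \<longlonglongrightarrow> l * (1 + norm d)"
      by (intro tendsto_intros)
    moreover have "1 + norm d \<noteq> 0"
      by (smt (verit) norm_ge_zero)
    ultimately have "Cauchy (\<lambda>n. f (r n) d)"
      by (auto intro!: LIMSEQ_imp_Cauchy)
    then obtain N where N: "\<And>m n. m \<ge> N \<Longrightarrow> n \<ge> N \<Longrightarrow> dist (f (r m) d) (f (r n) d) < e / 3"
      using e by (meson metric_CauchyD zero_less_divide_iff zero_less_numeral)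
    have near: "dist (f n d) (f n x) < e / 3" for n
    proof -
      have "dist (f n d) (f n x) \<le> L * dist d x"
        using lipschitz_onD[OF lip] by blast
      also have "\<dots> \<le> (L + 1) * dist d x"
        by (simp add: algebra_simps)
      also have "\<dots> < e / 3"
        using d(2) L by (simp add: field_simps)
      finally show ?thesis .
    qed
    have "dist (f (r m) x) (f (r n) x) < e" if "m \<ge> N" "n \<ge> N" for m n
      using N[OF that] near[of "r m"] near[of "r n"] unfolding dist_real_def by linarith
    then show "\<exists>N. \<forall>m\<ge>N. \<forall>n\<ge>N. dist (f (r m) x) (f (r n) x) < e"
      by blast
  qed
  then have "(\<lambda>n. f (r n) x) \<longlonglongrightarrow> lim (\<lambda>n. f (r n) x)" for x
    by (simp add: convergent_LIMSEQ_iff)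
  with r that[of r "\<lambda>x. lim (\<lambda>n. f (r n) x)"] show ?thesis
    by blast
qed

lemma lipschitz_on_pointwise_limit:
  fixes f :: "nat \<Rightarrow> 'a::metric_space \<Rightarrow> real"
  assumes lip: "\<And>n. L-lipschitz_on UNIV (f n)" and lim: "\<And>x. (\<lambda>n. f n x) \<longlonglongrightarrow> g x"
  shows "L-lipschitz_on UNIV g"
proof (rule lipschitz_on_realI)
  show "0 \<le> L"
    using lip lipschitz_on_nonneg by blast
  show "g x \<le> g y + L * dist x y" for x y
    by (rule LIMSEQ_le[OF lim tendsto_add[OF lim tendsto_const]])
      (use lipschitz_on_real_le[OF lip] in blast)
qed

lemma convex_on_pointwise_limit:
  fixes f :: "nat \<Rightarrow> 'a::real_vector \<Rightarrow> real"
  assumes cvx: "\<And>n. convex_on UNIV (f n)" and lim: "\<And>x. (\<lambda>n. f n x) \<longlonglongrightarrow> g x"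
  shows "convex_on UNIV g"
proof (rule convex_onI)
  fix t :: real and x y
  assume t: "0 < t" "t < 1"
  show "g ((1 - t) *\<^sub>R x + t *\<^sub>R y) \<le> (1 - t) * g x + t * g y"
    by (rule LIMSEQ_le[OF lim tendsto_add[OF tendsto_mult_left[OF lim] tendsto_mult_left[OF lim]]])
      (use t convex_onD[OF cvx] in auto)
qed simp

section \<open>Integration against measures with finite first moment\<close>

lemma P1_integrable_lipschitz:
  fixes f :: "'a::euclidean_space \<Rightarrow> real"
  assumes \<mu>: "\<mu> \<in> P1" and lip: "L-lipschitz_on UNIV f"
  shows "integrable \<mu> f"
proof (rule Bochner_Integration.integrable_bound)
  interpret prob_space \<mu>
    using \<mu> by (simp add: P1_def)
  have sets: "sets \<mu> = sets borel"
    using \<mu> by (simp add: P1_def)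
  show "integrable \<mu> (\<lambda>x. \<bar>f 0\<bar> + L * norm x)"
    using \<mu> by (auto simp: P1_def)
  show "f \<in> borel_measurable \<mu>"
    using borel_measurable_continuous_onI[OF lipschitz_on_continuous_on[OF lip]]
    by (simp add: measurable_cong_sets[OF sets refl])
  show "AE x in \<mu>. norm (f x) \<le> norm (\<bar>f 0\<bar> + L * norm x)"
  proof (rule AE_I2)
    fix x
    show "norm (f x) \<le> norm (\<bar>f 0\<bar> + L * norm x)"
      using lipschitz_onD[OF lip, of x 0] by (simp add: dist_real_def)
  qed
qed

lemma P1_integrable_Cb1:
  fixes f :: "'a::euclidean_space \<Rightarrow> real"
  assumes \<mu>: "\<mu> \<in> P1" and f: "f \<in> Cb1"
  shows "integrable \<mu> f"
proof -
  interpret prob_space \<mu>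
    using \<mu> by (simp add: P1_def)
  have sets: "sets \<mu> = sets borel"
    using \<mu> by (simp add: P1_def)
  obtain K where K: "\<bar>f x / (1 + norm x)\<bar> \<le> K" for x
    using f by (auto simp: Cb1_def bounded_iff)
  show ?thesis
  proof (rule Bochner_Integration.integrable_bound)
    show "integrable \<mu> (\<lambda>x. K * (1 + norm x))"
      using \<mu> by (auto simp: P1_def)
    show "f \<in> borel_measurable \<mu>"
      using f borel_measurable_continuous_onI[of f]
      by (simp add: Cb1_def measurable_cong_sets[OF sets refl])
    show "AE x in \<mu>. norm (f x) \<le> norm (K * (1 + norm x))"
    proof (rule AE_I2)
      fix x :: 'a
      have pos: "0 < 1 + norm x"
        by (smt (verit) norm_ge_zero)
      have "\<bar>f x\<bar> = \<bar>f x / (1 + norm x)\<bar> * (1 + norm x)"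
        using pos by (simp add: abs_divide)
      also have "\<dots> \<le> K * (1 + norm x)"
        using K[of x] pos by (intro mult_right_mono) auto
      finally show "norm (f x) \<le> norm (K * (1 + norm x))"
        by simp
    qed
  qed
qed

text \<open>Places the Lipschitz optimizers in the class over which the dual suprema are
  taken.\<close>

lemma lipschitz_imp_Cb1:
  fixes f :: "'a::euclidean_space \<Rightarrow> real"
  assumes lip: "L-lipschitz_on UNIV f"
  shows "f \<in> Cb1"
proof -
  have "norm (f x / (1 + norm x)) \<le> \<bar>f 0\<bar> + L" for x
  proof -
    have pos: "0 < 1 + norm x"
      by (smt (verit) norm_ge_zero)
    have "\<bar>f x\<bar> \<le> \<bar>f 0\<bar> + L * norm x"
      using lipschitz_onD[OF lip, of x 0] by (simp add: dist_real_def)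
    also have "\<dots> \<le> (\<bar>f 0\<bar> + L) * (1 + norm x)"
      using lipschitz_on_nonneg[OF lip] by (simp add: algebra_simps)
    finally show ?thesis
      using pos by (simp add: divide_simps)
  qed
  then show ?thesis
    using lipschitz_on_continuous_on[OF lip] by (auto simp: Cb1_def intro!: boundedI)
qed

text \<open>Dominated convergence; the majorant \<open>B + L * norm x\<close> is integrable by the
  finite first moment.\<close>

lemma tendsto_integral_lipschitz:
  fixes f :: "nat \<Rightarrow> 'a::euclidean_space \<Rightarrow> real"
  assumes \<mu>: "\<mu> \<in> P1" and lip: "\<And>n. L-lipschitz_on UNIV (f n)"
    and bdd: "\<And>n. \<bar>f n 0\<bar> \<le> B" and lim: "\<And>x. (\<lambda>n. f n x) \<longlonglongrightarrow> g x"
  shows "(\<lambda>n. \<integral>x. f n x \<partial>\<mu>) \<longlonglongrightarrow> (\<integral>x. g x \<partial>\<mu>)"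
proof (rule integral_dominated_convergence)
  interpret prob_space \<mu>
    using \<mu> by (simp add: P1_def)
  show "integrable \<mu> (\<lambda>x. B + L * norm x)"
    using \<mu> by (auto simp: P1_def)
  show "f n \<in> borel_measurable \<mu>" for n
    using P1_integrable_lipschitz[OF \<mu> lip] by blast
  show "g \<in> borel_measurable \<mu>"
    using P1_integrable_lipschitz[OF \<mu> lipschitz_on_pointwise_limit[OF lip lim]] by blast
  show "AE x in \<mu>. (\<lambda>n. f n x) \<longlonglongrightarrow> g x"
    using lim by simp
  show "AE x in \<mu>. norm (f n x) \<le> B + L * norm x" for n
  proof (rule AE_I2)
    fix x
    show "norm (f n x) \<le> B + L * norm x"
      using lipschitz_onD[OF lip, of x 0 n] bdd[of n] by (simp add: dist_real_def)
  qed
qed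

section \<open>Dual pairs and the real-valued transforms\<close>

text \<open>The last conjunct is the constraint of Kantorovich duality for the cost
  \<open>h (x - y)\<close>.\<close>

definition dual_pair :: "('a::euclidean_space \<Rightarrow> real) \<Rightarrow> real \<Rightarrow> ('a \<Rightarrow> real) \<Rightarrow> ('a \<Rightarrow> real) \<Rightarrow> bool"
  where "dual_pair h L a b \<longleftrightarrow> convex_on UNIV a \<and> convex_on UNIV b \<and>
    L-lipschitz_on UNIV a \<and> L-lipschitz_on UNIV b \<and> (\<forall>x y. a x \<le> b y + h (x - y))"

locale lipschitz_cost =
  fixes h :: "'a::euclidean_space \<Rightarrow> real" and L :: real
  assumes h_nonneg: "0 \<le> h x"
    and h_convex: "convex_on UNIV h"
    and h_lipschitz: "L-lipschitz_on UNIV h"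
begin

lemma L_nonneg: "0 \<le> L"
  using h_lipschitz lipschitz_on_nonneg by blast

lemma translate_lipschitz: "L-lipschitz_on UNIV (\<lambda>x. k + h (x - y))"
proof (rule lipschitz_on_realI)
  show "k + h (x - y) \<le> k + h (x' - y) + L * dist x x'" for x x'
    using lipschitz_on_real_le[OF h_lipschitz, of "x - y" "x' - y"] by (simp add: dist_norm)
qed (rule L_nonneg)

lemma reflect_lipschitz: "L-lipschitz_on UNIV (\<lambda>y. h (x - y) - k)"
proof (rule lipschitz_on_realI)
  show "h (x - y) - k \<le> h (x - y') - k + L * dist y y'" for y y'
    using lipschitz_on_real_le[OF h_lipschitz, of "x - y" "x - y'"]
    by (simp add: dist_norm norm_minus_commute)
qed (rule L_nonneg)

text \<open>Real-valued counterpart of \<open>Qc\<close>. The functions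
  \<open>\<phi> y + h (x - y)\<close> of \<open>x\<close> are all \<open>L\<close>-Lipschitz, so the
  bound at the single point \<open>x0\<close> yields a finite infimum everywhere. The last two
  conclusions characterize \<open>a x\<close> as a greatest lower bound.\<close>

lemma inf_transform:
  fixes \<phi> :: "'a \<Rightarrow> real"
  assumes \<phi>: "convex_on UNIV \<phi>" and bdd0: "\<And>y. m \<le> \<phi> y + h (x0 - y)"
  obtains a where "convex_on UNIV a" "L-lipschitz_on UNIV a"
    "\<And>x y. a x \<le> \<phi> y + h (x - y)"
    "\<And>x k. (\<And>y. k \<le> \<phi> y + h (x - y)) \<Longrightarrow> k \<le> a x"
proof
  let ?a = "\<lambda>x. INF y. \<phi> y + h (x - y)"
  have bdd: "bdd_below (range (\<lambda>y. \<phi> y + h (x - y)))" for x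
    by (rule bdd_below_lipschitz_family[where p = x0, OF translate_lipschitz])
      (auto intro: bdd_belowI2 bdd0)
  show "convex_on UNIV ?a"
    by (rule convex_on_infimal_convolution[OF \<phi> h_convex bdd])
  show "L-lipschitz_on UNIV ?a"
    by (rule lipschitz_on_INF[OF L_nonneg translate_lipschitz bdd])
  show "?a x \<le> \<phi> y + h (x - y)" for x y
    by (rule cINF_lower[OF bdd]) simp
  show "k \<le> ?a x" if "\<And>y. k \<le> \<phi> y + h (x - y)" for x k
    using that by (intro cINF_greatest) auto
qed

text \<open>Real-valued counterpart of \<open>Qcbar\<close>. Convexity is not visible in the
  original form, where \<open>- h (x - y)\<close> is concave in \<open>y\<close>. Substituting
  \<open>x = y + z\<close> removes \<open>y\<close> from the cost and leaves a supremum of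
  translates of \<open>\<psi>\<close> minus constants.\<close>

lemma sup_transform:
  fixes \<psi> :: "'a \<Rightarrow> real"
  assumes \<psi>: "convex_on UNIV \<psi>" and bdd0: "\<And>x. \<psi> x - h (x - y0) \<le> m"
  obtains b where "convex_on UNIV b" "L-lipschitz_on UNIV b"
    "\<And>x y. \<psi> x - h (x - y) \<le> b y"
    "\<And>y k. (\<And>x. \<psi> x - h (x - y) \<le> k) \<Longrightarrow> b y \<le> k"
proof
  let ?b = "\<lambda>y. SUP x. \<psi> x - h (x - y)"
  \<comment> \<open>The family is negated so that the lemma on lower bounds applies;
    \<open>bdd\<close> turns the result around.\<close>
  have bdd': "bdd_below (range (\<lambda>x. h (x - y) - \<psi> x))" for y
  proof (rule bdd_below_lipschitz_family[where p = y0, OF reflect_lipschitz])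
    have "- m \<le> h (x - y0) - \<psi> x" for x
      using bdd0[of x] by simp
    then show "bdd_below (range (\<lambda>x. h (x - y0) - \<psi> x))"
      by (rule bdd_belowI2)
  qed
  have bdd: "bdd_above (range (\<lambda>x. \<psi> x - h (x - y)))" for y
  proof -
    obtain k where "k \<le> h (x - y) - \<psi> x" for x
      using bdd'[of y] by (auto simp: bdd_below_def)
    then have "\<psi> x - h (x - y) \<le> - k" for x
      by (smt (verit))
    then show ?thesis
      by (rule bdd_aboveI2)
  qed
  show upper: "\<psi> x - h (x - y) \<le> ?b y" for x y
    by (rule cSUP_upper[OF _ bdd]) simp
  show least: "?b y \<le> k" if "\<And>x. \<psi> x - h (x - y) \<le> k" for y k
    using that by (intro cSUP_least) auto
  show "L-lipschitz_on UNIV ?b"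
  proof (rule lipschitz_on_realI[OF L_nonneg])
    fix y y'
    show "?b y \<le> ?b y' + L * dist y y'"
    proof (rule least)
      fix x
      show "\<psi> x - h (x - y) \<le> ?b y' + L * dist y y'"
        using upper[of x y'] lipschitz_on_real_le[OF reflect_lipschitz[of x 0], of y' y]
        by (simp add: dist_commute)
    qed
  qed
  have shift: "range (\<lambda>z. \<psi> (y + z) - h z) = range (\<lambda>x. \<psi> x - h (x - y))" for y
  proof (intro equalityI image_subsetI)
    show "\<psi> (y + z) - h z \<in> range (\<lambda>x. \<psi> x - h (x - y))" for z
      by (rule image_eqI[of _ _ "y + z"]) simp_all
    show "\<psi> x - h (x - y) \<in> range (\<lambda>z. \<psi> (y + z) - h z)" for x
      by (rule image_eqI[of _ _ "x - y"]) simp_all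
  qed
  have "convex_on UNIV (\<lambda>y. SUP z. \<psi> (y + z) - h z)"
  proof (rule convex_on_SUP_of_real)
    show "bdd_above (range (\<lambda>z. \<psi> (y + z) - h z))" for y
      unfolding shift by (rule bdd)
    show "convex_on UNIV (\<lambda>y. \<psi> (y + z) - h z)" for z
    proof (rule convex_onI)
      fix t :: real and x y
      assume t: "0 < t" "t < 1"
      have "(1 - t) *\<^sub>R x + t *\<^sub>R y + z = (1 - t) *\<^sub>R (x + z) + t *\<^sub>R (y + z)"
        by (simp add: algebra_simps)
      then show "\<psi> ((1 - t) *\<^sub>R x + t *\<^sub>R y + z) - h z
          \<le> (1 - t) * (\<psi> (x + z) - h z) + t * (\<psi> (y + z) - h z)"
        using t convex_onD[OF \<psi>, of t "x + z" "y + z"] by (simp add: algebra_simps)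
    qed simp
  qed
  then show "convex_on UNIV ?b"
    unfolding shift .
qed

section \<open>Existence of a maximal dual pair\<close>

text \<open>Direct method. Subtracting one constant from both functions changes neither the
  constraint nor the value, so \<open>b 0 = 0\<close> can be imposed; this removes the only
  obstruction to compactness.\<close>

lemma maximal_dual_pair:
  assumes \<mu>: "\<mu> \<in> P1" and \<nu>: "\<nu> \<in> P1"
  obtains a b where "dual_pair h L a b"
    "\<And>a' b'. dual_pair h L a' b' \<Longrightarrow>
      (\<integral>x. a' x \<partial>\<mu>) - (\<integral>y. b' y \<partial>\<nu>) \<le> (\<integral>x. a x \<partial>\<mu>) - (\<integral>y. b y \<partial>\<nu>)"
proof -
  interpret \<mu>: prob_space \<mu>
    using \<mu> by (simp add: P1_def)
  interpret \<nu>: prob_space \<nu>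
    using \<nu> by (simp add: P1_def)
  have norm_int: "integrable \<mu> norm" "integrable \<nu> norm"
    using \<mu> \<nu> by (auto simp: P1_def)
  define J where "J a b = (\<integral>x. a x \<partial>\<mu>) - (\<integral>y. b y \<partial>\<nu>)" for a b :: "'a \<Rightarrow> real"
  define C where "C = L * (\<integral>x. norm x \<partial>\<mu>) + L * (\<integral>y. norm y \<partial>\<nu>)"
  have int: "integrable \<mu> a" "integrable \<nu> b" if "dual_pair h L a b" for a b
    using that P1_integrable_lipschitz[OF \<mu>] P1_integrable_lipschitz[OF \<nu>]
    by (auto simp: dual_pair_def)
  \<comment> \<open>The Lipschitz bounds compare \<open>a\<close> and \<open>b\<close> with their
    values at \<open>0\<close>; \<open>C\<close> collects the first moments this costs.\<close>
  have J_le: "J a b \<le> a 0 - b 0 + C" if ab: "dual_pair h L a b" for a b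
  proof -
    have a: "a x \<le> a 0 + L * norm x" and b: "b 0 - L * norm x \<le> b x" for x
      using ab lipschitz_on_real_le[of L a x 0] lipschitz_on_real_le[of L b 0 x]
      by (auto simp: dual_pair_def)
    have "(\<integral>x. a x \<partial>\<mu>) \<le> (\<integral>x. a 0 + L * norm x \<partial>\<mu>)"
      by (intro integral_mono a int[OF ab]) (use norm_int in auto)
    moreover have "(\<integral>x. b 0 - L * norm x \<partial>\<nu>) \<le> (\<integral>x. b x \<partial>\<nu>)"
      by (intro integral_mono b int[OF ab]) (use norm_int in auto)
    ultimately show ?thesis
      using norm_int by (simp add: J_def C_def \<mu>.prob_space \<nu>.prob_space)
  qed
  define V where "V = {J a b | a b. dual_pair h L a b}"
  \<comment> \<open>The zero pair is admissible because \<open>h\<close> is nonnegative; it makes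
    \<open>V\<close> nonempty and \<open>Sup V\<close> nonnegative.\<close>
  have "dual_pair h L (\<lambda>_. 0) (\<lambda>_. 0)"
    using h_nonneg L_nonneg by (auto simp: dual_pair_def intro!: lipschitz_onI convex_onI)
  then have V0: "0 \<in> V"
    by (force simp: V_def J_def)
  have V_bdd: "bdd_above V"
  proof (rule bdd_aboveI)
    fix v
    assume "v \<in> V"
    then obtain a b where ab: "dual_pair h L a b" and v: "v = J a b"
      by (auto simp: V_def)
    have "a 0 \<le> b 0 + h (0 - 0)"
      using ab unfolding dual_pair_def by blast
    then show "v \<le> h 0 + C"
      using J_le[OF ab] v by simp
  qed
  have V_sup: "0 \<le> Sup V"
    by (rule cSup_upper[OF V0 V_bdd])
  \<comment> \<open>A nearly optimal pair is shifted by \<open>b 0\<close>; its value is unchanged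
    because both measures have mass one.\<close>
  have "\<exists>a b. dual_pair h L a b \<and> b 0 = 0 \<and> Sup V - inverse (real (Suc n)) < J a b" for n
  proof -
    obtain v where "v \<in> V" "Sup V - inverse (real (Suc n)) < v"
      using less_cSupD[of V "Sup V - inverse (real (Suc n))"] V0 by auto
    then obtain a b where ab: "dual_pair h L a b" "Sup V - inverse (real (Suc n)) < J a b"
      by (auto simp: V_def)
    have lip: "L-lipschitz_on UNIV (\<lambda>x. f x - b 0)" if "L-lipschitz_on UNIV f" for f :: "'a \<Rightarrow> real"
      using that by (simp add: lipschitz_on_def dist_real_def)
    have cvx: "convex_on UNIV (\<lambda>x. f x - b 0)" if f: "convex_on UNIV f" for f :: "'a \<Rightarrow> real"
    proof (rule convex_onI)
      fix t :: real and x y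
      assume "0 < t" "t < 1"
      then show "f ((1 - t) *\<^sub>R x + t *\<^sub>R y) - b 0 \<le> (1 - t) * (f x - b 0) + t * (f y - b 0)"
        using convex_onD[OF f, of t x y] by (simp add: algebra_simps)
    qed simp
    have "dual_pair h L (\<lambda>x. a x - b 0) (\<lambda>x. b x - b 0)"
      using ab(1) by (auto simp: dual_pair_def lip cvx)
    moreover have "J (\<lambda>x. a x - b 0) (\<lambda>x. b x - b 0) = J a b"
      using int[OF ab(1)] by (simp add: J_def \<mu>.prob_space \<nu>.prob_space)
    ultimately show ?thesis
      using ab(2) by (intro exI[of _ "\<lambda>x. a x - b 0"] exI[of _ "\<lambda>x. b x - b 0"]) simp
  qed
  then obtain a b where pair: "\<And>n. dual_pair h L (a n) (b n)" and b0: "\<And>n. b n 0 = 0"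
    and near: "\<And>n. Sup V - inverse (real (Suc n)) < J (a n) (b n)"
    by metis
  have lip: "L-lipschitz_on UNIV (a n)" "L-lipschitz_on UNIV (b n)"
    and cvx: "convex_on UNIV (a n)" "convex_on UNIV (b n)"
    and le: "a n x \<le> b n y + h (x - y)" for n x y
    using pair[of n] by (auto simp: dual_pair_def)
  \<comment> \<open>The upper bound is the constraint at \<open>x = y = 0\<close>. The lower bound
    comes from near optimality: the value exceeds \<open>Sup V - 1\<close>, hence
    \<open>- 1\<close>, and \<open>J_le\<close> bounds it by \<open>a n 0 + C\<close>.\<close>
  have a0: "\<bar>a n 0\<bar> \<le> h 0 + \<bar>C\<bar> + 1" for n
  proof -
    have "inverse (real (Suc n)) \<le> 1"
      by (simp add: inverse_eq_divide)
    then have "- 1 \<le> a n 0 + C"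
      using near[of n] V_sup J_le[OF pair[of n]] b0[of n] by linarith
    moreover have "a n 0 \<le> h 0"
      using le[of n 0 0] b0[of n] by simp
    ultimately show ?thesis
      using h_nonneg[of 0] by linarith
  qed
  obtain r A where r: "strict_mono (r :: nat \<Rightarrow> nat)" and A: "\<And>x. (\<lambda>n. a (r n) x) \<longlonglongrightarrow> A x"
    by (rule lipschitz_pointwise_convergent_subsequence[of L a, OF lip(1) a0]) (rule that)
  \<comment> \<open>A second extraction inside the first; by the normalization, the bound at
    \<open>0\<close> is \<open>0\<close>.\<close>
  obtain s B where s: "strict_mono (s :: nat \<Rightarrow> nat)" and B: "\<And>x. (\<lambda>n. b (r (s n)) x) \<longlonglongrightarrow> B x"
    by (rule lipschitz_pointwise_convergent_subsequence[of L "\<lambda>n. b (r n)" 0, OF lip(2)])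
      (simp add: b0, rule that)
  have A': "(\<lambda>n. a (r (s n)) x) \<longlonglongrightarrow> A x" for x
    using LIMSEQ_subseq_LIMSEQ[OF A s] by (simp add: o_def)
  have "A x \<le> B y + h (x - y)" for x y
    by (rule LIMSEQ_le[OF A' tendsto_add[OF B tendsto_const]]) (use le in blast)
  then have AB: "dual_pair h L A B"
    using lipschitz_on_pointwise_limit[where f = "\<lambda>n. a (r (s n))", OF lip(1) A']
      lipschitz_on_pointwise_limit[where f = "\<lambda>n. b (r (s n))", OF lip(2) B]
      convex_on_pointwise_limit[where f = "\<lambda>n. a (r (s n))", OF cvx(1) A']
      convex_on_pointwise_limit[where f = "\<lambda>n. b (r (s n))", OF cvx(2) B]
    by (simp add: dual_pair_def)
  have J_lim: "(\<lambda>n. J (a (r (s n))) (b (r (s n)))) \<longlonglongrightarrow> J A B"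
    unfolding J_def
    using tendsto_integral_lipschitz[where f = "\<lambda>n. a (r (s n))", OF \<mu> lip(1) a0 A']
      tendsto_integral_lipschitz[where f = "\<lambda>n. b (r (s n))" and B = 0, OF \<nu> lip(2) _ B]
    by (intro tendsto_diff) (simp_all add: b0)
  have Sup_lim: "(\<lambda>n. Sup V - inverse (real (Suc (r (s n))))) \<longlonglongrightarrow> Sup V - 0"
    using LIMSEQ_subseq_LIMSEQ[OF LIMSEQ_inverse_real_of_nat strict_mono_o[OF r s]]
    by (intro tendsto_diff tendsto_const) (simp add: o_def)
  have "Sup V \<le> J A B"
    using LIMSEQ_le[OF Sup_lim J_lim] near[THEN less_imp_le] by simp
  moreover have "J a' b' \<le> Sup V" if "dual_pair h L a' b'" for a' b'
    using that by (intro cSup_upper[OF _ V_bdd]) (auto simp: V_def)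
  ultimately have "J a' b' \<le> J A B" if "dual_pair h L a' b'" for a' b'
    using that order_trans by blast
  with AB that show ?thesis
    by (auto simp: J_def)
qed

end

section \<open>The extended real valued transforms\<close>

lemma (in prob_space) ext_integral_infinite:
  "ext_integral M (\<lambda>_. - \<infinity>) = - \<infinity>" "ext_integral M (\<lambda>_. \<infinity>) = \<infinity>"
  by (simp_all add: ext_integral_def emeasure_space_1 e2ennreal_neg zero_ennreal.rep_eq)

context lipschitz_cost
begin

text \<open>There is no mixed case: by \<open>inf_transform\<close>, a finite lower bound at one
  point makes the transform real-valued everywhere.\<close>

lemma Qc_cases:
  assumes \<phi>: "convex_on UNIV \<phi>"
  obtains "Qc (\<lambda>x y. h (x - y)) \<phi> = (\<lambda>_. - \<infinity>)"
  | a where "convex_on UNIV a" "L-lipschitz_on UNIV a" "\<And>x. Qc (\<lambda>x y. h (x - y)) \<phi> x = ereal (a x)"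
    "\<And>x y. a x \<le> \<phi> y + h (x - y)" "\<And>x k. (\<And>y. k \<le> \<phi> y + h (x - y)) \<Longrightarrow> k \<le> a x"
proof (cases "\<exists>x m. \<forall>y. m \<le> \<phi> y + h (x - y)")
  case True
  then obtain x0 m where "m \<le> \<phi> y + h (x0 - y)" for y
    by blast
  then obtain a where a: "convex_on UNIV a" "L-lipschitz_on UNIV a"
    "\<And>x y. a x \<le> \<phi> y + h (x - y)" "\<And>x k. (\<And>y. k \<le> \<phi> y + h (x - y)) \<Longrightarrow> k \<le> a x"
    using inf_transform[OF \<phi>] by metis
  have "Qc (\<lambda>x y. h (x - y)) \<phi> x = ereal (a x)" for x
    unfolding Qc_def
  proof (rule INF_eqI)
    fix z
    assume z: "\<And>y. y \<in> UNIV \<Longrightarrow> z \<le> ereal (\<phi> y + h (x - y))"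
    then show "z \<le> ereal (a x)"
      \<comment> \<open>The instance \<open>y = x\<close> excludes \<open>z = \<infinity>\<close>;
        for real \<open>z\<close> the greatest lower bound property applies.\<close>
      using z[of x] a(4) by (cases z) auto
  qed (simp add: a(3))
  with a that(2) show ?thesis
    by blast
next
  case False
  have "Qc (\<lambda>x y. h (x - y)) \<phi> x = - \<infinity>" for x
    unfolding Qc_def
  proof (rule INF_eqI)
    fix z
    assume z: "\<And>y. y \<in> UNIV \<Longrightarrow> z \<le> ereal (\<phi> y + h (x - y))"
    show "z \<le> - \<infinity>"
      using z False by (cases z) auto
  qed simp
  with that(1) show ?thesis
    by blast
qed

text \<open>Mirror image of \<open>Qc_cases\<close>, resting on
  \<open>sup_transform\<close>.\<close>

lemma Qcbar_cases:
  assumes \<psi>: "convex_on UNIV \<psi>"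
  obtains "Qcbar (\<lambda>x y. h (x - y)) \<psi> = (\<lambda>_. \<infinity>)"
  | b where "convex_on UNIV b" "L-lipschitz_on UNIV b" "\<And>y. Qcbar (\<lambda>x y. h (x - y)) \<psi> y = ereal (b y)"
    "\<And>x y. \<psi> x - h (x - y) \<le> b y" "\<And>y k. (\<And>x. \<psi> x - h (x - y) \<le> k) \<Longrightarrow> b y \<le> k"
proof (cases "\<exists>y m. \<forall>x. \<psi> x - h (x - y) \<le> m")
  case True
  then obtain y0 m where "\<psi> x - h (x - y0) \<le> m" for x
    by blast
  then obtain b where b: "convex_on UNIV b" "L-lipschitz_on UNIV b"
    "\<And>x y. \<psi> x - h (x - y) \<le> b y" "\<And>y k. (\<And>x. \<psi> x - h (x - y) \<le> k) \<Longrightarrow> b y \<le> k"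
    using sup_transform[OF \<psi>] by metis
  have "Qcbar (\<lambda>x y. h (x - y)) \<psi> y = ereal (b y)" for y
    unfolding Qcbar_def
  proof (rule SUP_eqI)
    fix z
    assume z: "\<And>x. x \<in> UNIV \<Longrightarrow> ereal (\<psi> x - h (x - y)) \<le> z"
    then show "ereal (b y) \<le> z"
      using z[of y] b(4) by (cases z) auto
  qed (simp add: b(3))
  with b that(2) show ?thesis
    by blast
next
  case False
  have "Qcbar (\<lambda>x y. h (x - y)) \<psi> y = \<infinity>" for y
    unfolding Qcbar_def
  proof (rule SUP_eqI)
    fix z
    assume z: "\<And>x. x \<in> UNIV \<Longrightarrow> ereal (\<psi> x - h (x - y)) \<le> z"
    show "\<infinity> \<le> z"
      using z False by (cases z) auto
  qed simp
  with that(1) show ?thesis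
    by blast
qed

section \<open>Comparing the two functionals with dual pairs\<close>

text \<open>If the transform is \<open>- \<infinity>\<close>, so is the functional. Otherwise
  \<open>a\<close> is the transform of \<open>\<phi>\<close> and \<open>b\<close> that of
  \<open>a\<close>; then \<open>b\<close> lies below \<open>\<phi>\<close>, so passing to the pair
  can only raise the value.\<close>

lemma backward_functional_le_dual_pair:
  assumes \<mu>: "\<mu> \<in> P1" and \<nu>: "\<nu> \<in> P1" and \<phi>: "\<phi> \<in> Cvx \<inter> Cb1"
    and V: "\<And>a b. dual_pair h L a b \<Longrightarrow> (\<integral>x. a x \<partial>\<mu>) - (\<integral>y. b y \<partial>\<nu>) \<le> V"
  shows "backward_functional (\<lambda>x y. h (x - y)) \<mu> \<nu> \<phi> \<le> ereal V"
proof -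
  have cvx: "convex_on UNIV \<phi>"
    using \<phi> by (simp add: Cvx_def)
  from cvx show ?thesis
  proof (cases rule: Qc_cases)
    case 1
    have "ext_integral \<mu> (\<lambda>_. - \<infinity>) = - \<infinity>"
      using \<mu> by (simp add: P1_def prob_space.ext_integral_infinite)
    with 1 show ?thesis
      by (simp add: backward_functional_def)
  next
    case (2 a)
    \<comment> \<open>Supplies the bound at one point that \<open>sup_transform\<close> requires,
      with \<open>y0 = 0\<close>.\<close>
    have "a x - h (x - 0) \<le> \<phi> 0" for x
      using 2(4)[of x 0] by (simp add: algebra_simps)
    then obtain b where b: "convex_on UNIV b" "L-lipschitz_on UNIV b"
      "\<And>x y. a x - h (x - y) \<le> b y" "\<And>y k. (\<And>x. a x - h (x - y) \<le> k) \<Longrightarrow> b y \<le> k"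
      using sup_transform[OF 2(1)] by metis
    have ab: "dual_pair h L a b"
      using 2(1,2) b by (auto simp: dual_pair_def algebra_simps)
    \<comment> \<open>\<open>b y\<close> is a least upper bound, and \<open>\<phi> y\<close> is an
      upper bound by the constraint between \<open>a\<close> and \<open>\<phi>\<close>.\<close>
    have "b y \<le> \<phi> y" for y
      using 2(4) by (intro b(4)) (simp add: algebra_simps)
    then have "(\<integral>y. b y \<partial>\<nu>) \<le> (\<integral>y. \<phi> y \<partial>\<nu>)"
      using P1_integrable_lipschitz[OF \<nu> b(2)] P1_integrable_Cb1[OF \<nu>] \<phi> by (intro integral_mono) auto
    moreover have "ext_integral \<mu> (Qc (\<lambda>x y. h (x - y)) \<phi>) = ereal (\<integral>x. a x \<partial>\<mu>)"
      using ext_integral_ereal[OF P1_integrable_lipschitz[OF \<mu> 2(2)]] by (simp add: ext[OF 2(3)])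
    ultimately show ?thesis
      using V[OF ab] by (simp add: backward_functional_def)
  qed
qed

text \<open>Here \<open>b\<close> is the transform of \<open>\<psi>\<close>, and transforming back
  gives \<open>a\<close> above \<open>\<psi>\<close>, which raises the first integral.\<close>

lemma forward_functional_le_dual_pair:
  assumes \<mu>: "\<mu> \<in> P1" and \<nu>: "\<nu> \<in> P1" and \<psi>: "\<psi> \<in> Cvx \<inter> Cb1"
    and V: "\<And>a b. dual_pair h L a b \<Longrightarrow> (\<integral>x. a x \<partial>\<mu>) - (\<integral>y. b y \<partial>\<nu>) \<le> V"
  shows "forward_functional (\<lambda>x y. h (x - y)) \<mu> \<nu> \<psi> \<le> ereal V"
proof -
  have cvx: "convex_on UNIV \<psi>"
    using \<psi> by (simp add: Cvx_def)
  from cvx show ?thesis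
  proof (cases rule: Qcbar_cases)
    case 1
    have "ext_integral \<nu> (\<lambda>_. \<infinity>) = \<infinity>"
      using \<nu> by (simp add: P1_def prob_space.ext_integral_infinite)
    with 1 show ?thesis
      by (simp add: forward_functional_def)
  next
    case (2 b)
    have "\<psi> 0 \<le> b y + h (0 - y)" for y
      using 2(4)[of 0 y] by (simp add: algebra_simps)
    then obtain a where a: "convex_on UNIV a" "L-lipschitz_on UNIV a"
      "\<And>x y. a x \<le> b y + h (x - y)" "\<And>x k. (\<And>y. k \<le> b y + h (x - y)) \<Longrightarrow> k \<le> a x"
      using inf_transform[OF 2(1)] by metis
    have ab: "dual_pair h L a b"
      using 2(1,2) a by (auto simp: dual_pair_def)
    have "\<psi> x \<le> a x" for x
      using 2(4) by (intro a(4)) (simp add: algebra_simps)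
    then have "(\<integral>x. \<psi> x \<partial>\<mu>) \<le> (\<integral>x. a x \<partial>\<mu>)"
      using P1_integrable_lipschitz[OF \<mu> a(2)] P1_integrable_Cb1[OF \<mu>] \<psi> by (intro integral_mono) auto
    moreover have "ext_integral \<nu> (Qcbar (\<lambda>x y. h (x - y)) \<psi>) = ereal (\<integral>y. b y \<partial>\<nu>)"
      using ext_integral_ereal[OF P1_integrable_lipschitz[OF \<nu> 2(2)]] by (simp add: ext[OF 2(3)])
    ultimately show ?thesis
      using V[OF ab] by (simp add: forward_functional_def)
  qed
qed

text \<open>\<open>Qc\<close> applied to \<open>b\<close> is the largest function compatible with
  \<open>b\<close> in the constraint, so it dominates \<open>a\<close>.\<close>

lemma dual_pair_le_backward_functional:
  assumes \<mu>: "\<mu> \<in> P1" and ab: "dual_pair h L a b"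
  shows "ereal ((\<integral>x. a x \<partial>\<mu>) - (\<integral>y. b y \<partial>\<nu>)) \<le> backward_functional (\<lambda>x y. h (x - y)) \<mu> \<nu> b"
proof -
  have le: "a x \<le> b y + h (x - y)" for x y
    using ab by (simp add: dual_pair_def)
  have cvx: "convex_on UNIV b"
    using ab by (simp add: dual_pair_def)
  from cvx show ?thesis
  proof (cases rule: Qc_cases)
    case 1
    \<comment> \<open>The constraint keeps the transform at \<open>0\<close> above a real number, so
      this case is contradictory.\<close>
    have "ereal (a 0) \<le> Qc (\<lambda>x y. h (x - y)) b 0"
      unfolding Qc_def using le[of 0] by (intro INF_greatest) simp
    with 1 show ?thesis
      by simp
  next
    case (2 q)
    have "a x \<le> q x" for x
      using le by (rule 2(5))
    then have "(\<integral>x. a x \<partial>\<mu>) \<le> (\<integral>x. q x \<partial>\<mu>)"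
      using ab P1_integrable_lipschitz[OF \<mu>] 2(2) by (intro integral_mono) (auto simp: dual_pair_def)
    moreover have "ext_integral \<mu> (Qc (\<lambda>x y. h (x - y)) b) = ereal (\<integral>x. q x \<partial>\<mu>)"
      using ext_integral_ereal[OF P1_integrable_lipschitz[OF \<mu> 2(2)]] by (simp add: ext[OF 2(3)])
    ultimately show ?thesis
      by (simp add: backward_functional_def)
  qed
qed

text \<open>\<open>Qcbar\<close> applied to \<open>a\<close> is the smallest function compatible
  with \<open>a\<close>, so it lies below \<open>b\<close>.\<close>

lemma dual_pair_le_forward_functional:
  assumes \<nu>: "\<nu> \<in> P1" and ab: "dual_pair h L a b"
  shows "ereal ((\<integral>x. a x \<partial>\<mu>) - (\<integral>y. b y \<partial>\<nu>)) \<le> forward_functional (\<lambda>x y. h (x - y)) \<mu> \<nu> a"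
proof -
  have le: "a x - h (x - y) \<le> b y" for x y
    using ab by (simp add: dual_pair_def algebra_simps)
  have cvx: "convex_on UNIV a"
    using ab by (simp add: dual_pair_def)
  from cvx show ?thesis
  proof (cases rule: Qcbar_cases)
    case 1
    have "Qcbar (\<lambda>x y. h (x - y)) a 0 \<le> ereal (b 0)"
      unfolding Qcbar_def using le[of _ 0] by (intro SUP_least) simp
    with 1 show ?thesis
      by simp
  next
    case (2 q)
    have "q y \<le> b y" for y
      using le by (rule 2(5))
    then have "(\<integral>y. q y \<partial>\<nu>) \<le> (\<integral>y. b y \<partial>\<nu>)"
      using ab P1_integrable_lipschitz[OF \<nu>] 2(2) by (intro integral_mono) (auto simp: dual_pair_def)
    moreover have "ext_integral \<nu> (Qcbar (\<lambda>x y. h (x - y)) a) = ereal (\<integral>y. q y \<partial>\<nu>)"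
      using ext_integral_ereal[OF P1_integrable_lipschitz[OF \<nu> 2(2)]] by (simp add: ext[OF 2(3)])
    ultimately show ?thesis
      by (simp add: forward_functional_def)
  qed
qed

end

section \<open>Attainment of both duals by one maximal pair\<close>

theorem theorem4:
  fixes \<mu> \<nu> :: "'a::euclidean_space measure"
    and h :: "'a \<Rightarrow> real" and L :: real
    and c :: "'a \<Rightarrow> 'a \<Rightarrow> real"
  assumes "\<mu> \<in> P1" and "\<nu> \<in> P1"
    and "\<And>x. 0 \<le> h x"
    and "convex_on UNIV h"
    and "0 < L" and "L-lipschitz_on UNIV h"
    and "\<And>x y. c x y = h (x - y)"
  shows "(\<exists>\<phi> \<in> Cvx \<inter> Lip. L-lipschitz_on UNIV \<phi> \<and>
            backward_functional c \<mu> \<nu> \<phi> = backward_dual c \<mu> \<nu>) \<and>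
         (\<exists>\<psi> \<in> Cvx \<inter> Lip. L-lipschitz_on UNIV \<psi> \<and>
            forward_functional c \<mu> \<nu> \<psi> = forward_dual c \<mu> \<nu>)"
proof -
  interpret lipschitz_cost h L
    using assms by unfold_locales auto
  have c: "c = (\<lambda>x y. h (x - y))"
    using assms(7) by blast
  obtain a b where ab: "dual_pair h L a b"
    and max: "\<And>a' b'. dual_pair h L a' b' \<Longrightarrow>
      (\<integral>x. a' x \<partial>\<mu>) - (\<integral>y. b' y \<partial>\<nu>) \<le> (\<integral>x. a x \<partial>\<mu>) - (\<integral>y. b y \<partial>\<nu>)"
    using maximal_dual_pair[OF assms(1,2)] by blast
  have lip: "L-lipschitz_on UNIV a" "L-lipschitz_on UNIV b"
    and cvx: "a \<in> Cvx" "b \<in> Cvx"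
    using ab by (auto simp: dual_pair_def Cvx_def)
  \<comment> \<open>The value of the maximal pair lies between the two sides: it bounds the
    functional at every competitor \<open>\<phi>\<close> and is bounded by the functional at
    \<open>b\<close>.\<close>
  have "backward_functional c \<mu> \<nu> \<phi> \<le> backward_functional c \<mu> \<nu> b" if "\<phi> \<in> Cvx \<inter> Cb1" for \<phi>
    unfolding c
    using backward_functional_le_dual_pair[OF assms(1,2) that max]
      dual_pair_le_backward_functional[OF assms(1) ab] by (rule order_trans)
  then have "backward_functional c \<mu> \<nu> b = backward_dual c \<mu> \<nu>"
    unfolding backward_dual_def
    using cvx lipschitz_imp_Cb1[OF lip(2)] by (intro antisym SUP_upper SUP_least) auto
  moreover have "forward_functional c \<mu> \<nu> \<psi> \<le> forward_functional c \<mu> \<nu> a" if "\<psi> \<in> Cvx \<inter> Cb1" for \<psi>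
    unfolding c
    using forward_functional_le_dual_pair[OF assms(1,2) that max]
      dual_pair_le_forward_functional[OF assms(2) ab] by (rule order_trans)
  then have "forward_functional c \<mu> \<nu> a = forward_dual c \<mu> \<nu>"
    unfolding forward_dual_def
    using cvx lipschitz_imp_Cb1[OF lip(1)] by (intro antisym SUP_upper SUP_least) auto
  ultimately show ?thesis
    using lip cvx by (auto simp: Lip_def)
qed

end
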